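(* For every finite set $S=S_C\cup S_f$, where $S_C$ is a finite set of equations between constants of a finite set $C$ and $S_f$ is a finite set of equations between $f$-monomials over $C$ ($f$ an AC symbol), and every total admissible ordering $\gg_f$ on $f$-monomials extending a total ordering $\gg$ on $C$, the algorithm SingleACCompletion$(S,\gg_f)$ terminates; that is, rules cannot be added to $R_f$ infinitely often.
   Context: $f$-monomials: for an AC symbol $f$ and finite set $C$ of constants, $f(M)$ with $M$ a nonempty finite multiset over $C$; a constant $c$ is identified with $f(\{\!\{c\}\!\})$. On multisets $\cup$ is multiset sum, $\cap$ multiset intersection (min of multiplicities), $-$ truncated multiset difference, $\subseteq$ sub-multiset. A rule $f(A)\rightarrow f(B)$ rewrites $f(M)$ to $f((M-A)\cup B)$ when $A\subseteq M$. An ordering $\gg_f$ on $f$-monomials is admissible if it is a total well-founded ordering extending a total ordering $\gg$ on $C$ such that (i) $f(A)\gg_f f(B)$ whenever $B$ is a proper sub-multiset of $A$, and (ii) $f(A_1)\gg_f f(A_2)$ implies $f(A_1\cup B)\gg_f f(A_2\cup B)$ for every multiset $B$. For distinct rules $f(A_1)\rightarrow f(A_2)$, $f(B_1)\rightarrow f(B_2)$ with $AB=(A_1\cup B_1)-(A_1\cap B_1)$, their critical pair is $(f((AB-A_1)\cup A_2), f((AB-B_1)\cup B_2))$. Algorithm SingleACCompletion$(S_f\cup S_C,\gg_f)$: (1) For each constant $c$, let $\hat c$ be the $\gg$-least constant in the equivalence class of $c$ generated by $S_C$; let $R_C=\{c\rightarrow\hat c\mid c\neq \hat c\}$; set $R_f:=R_C$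 and $T:=S_f$. (2) Pick and remove an equation $l=r$ from $T$; compute normal forms $\hat l,\hat r$ with respect to $R_f$; if they are equal discard the equation, otherwise orient it with $\gg_f$ into a rule, say $\hat l\rightarrow\hat r$ with $\hat l\gg_f\hat r$. (3) Add to $T$ the critical pairs (as equations) between $\hat l\rightarrow\hat r$ and every rule of $R_f$. (4) Add $\hat l\rightarrow\hat r$ to $R_f$ and interreduce: for every other rule $l\rightarrow r$ of $R_f$, if $l$ is reducible by the new rule, remove $l\rightarrow r$ from $R_f$ and insert $l=r$ into $T$; else if $r$ is reducible by the new rule, replace $r$ by a normal form $r'$ of (the reduct of) $r$, i.e. replace the rule by $l\rightarrow r'$. (5) Repeat steps (2)–(4) until $T$ is empty and the critical pairs among all pairs of rules in $R_f$ are joinable. (6) Output $R_f$. *)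

theory Defs
  imports "HOL-Library.Multiset"
begin

text \<open>The AC symbol \<open>f\<close> is fixed throughout, so the \<open>f\<close>-monomial \<open>f(M)\<close> is represented by the
  multiset \<open>M\<close>, and the constant \<open>c\<close> by \<open>{#c#}\<close>. In the multiset library, the multiset sum
  (written as a union in the informal text) is \<open>+\<close>.\<close>

definition monomials :: "'c set \<Rightarrow> 'c multiset set" where
  "monomials C = {M. M \<noteq> {#} \<and> set_mset M \<subseteq> C}"

type_synonym 'c equation = "'c multiset \<times> 'c multiset"
type_synonym 'c rule = "'c multiset \<times> 'c multiset"

definition strict_total_order_on :: "'a set \<Rightarrow> ('a \<Rightarrow> 'a \<Rightarrow> bool) \<Rightarrow> bool" where
  "strict_total_order_on A gt \<longleftrightarrow> irreflp_on A gt \<and> transp_on A gt \<and> totalp_on A gt"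

definition admissible ::
  "'c set \<Rightarrow> ('c \<Rightarrow> 'c \<Rightarrow> bool) \<Rightarrow> ('c multiset \<Rightarrow> 'c multiset \<Rightarrow> bool) \<Rightarrow> bool" where
  "admissible C gt gtf \<longleftrightarrow>
     strict_total_order_on (monomials C) gtf \<and>
     wfp_on (monomials C) (\<lambda>M N. gtf N M) \<and>
     (\<forall>c\<in>C. \<forall>d\<in>C. gt c d \<longrightarrow> gtf {#c#} {#d#}) \<and>
     (\<forall>A\<in>monomials C. \<forall>B\<in>monomials C. B \<subset># A \<longrightarrow> gtf A B) \<and>
     (\<forall>A1\<in>monomials C. \<forall>A2\<in>monomials C. \<forall>B. set_mset B \<subseteq> C \<longrightarrow>
        gtf A1 A2 \<longrightarrow> gtf (A1 + B) (A2 + B))"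

definition rewrite :: "'c rule set \<Rightarrow> 'c multiset \<Rightarrow> 'c multiset \<Rightarrow> bool" where
  "rewrite R M N \<longleftrightarrow> (\<exists>A B. (A, B) \<in> R \<and> A \<subseteq># M \<and> N = (M - A) + B)"

definition reducible :: "'c rule set \<Rightarrow> 'c multiset \<Rightarrow> bool" where
  "reducible R M \<longleftrightarrow> (\<exists>N. rewrite R M N)"

text \<open>A relation rather than a function: a monomial may have several normal forms.\<close>

definition normal_form :: "'c rule set \<Rightarrow> 'c multiset \<Rightarrow> 'c multiset \<Rightarrow> bool" where
  "normal_form R M N \<longleftrightarrow> (rewrite R)\<^sup>*\<^sup>* M N \<and> \<not> reducible R N"

definition joinable :: "'c rule set \<Rightarrow> 'c multiset \<Rightarrow> 'c multiset \<Rightarrow> bool" where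
  "joinable R M N \<longleftrightarrow> (\<exists>K. (rewrite R)\<^sup>*\<^sup>* M K \<and> (rewrite R)\<^sup>*\<^sup>* N K)"

fun critical_pair :: "'c rule \<Rightarrow> 'c rule \<Rightarrow> 'c equation" where
  "critical_pair (A1, A2) (B1, B2) =
     (let AB = (A1 + B1) - (A1 \<inter># B1) in ((AB - A1) + A2, (AB - B1) + B2))"

definition least_rep :: "('c \<times> 'c) set \<Rightarrow> ('c \<Rightarrow> 'c \<Rightarrow> bool) \<Rightarrow> 'c \<Rightarrow> 'c" where
  "least_rep SC gt c =
     (THE d. equivclp (\<lambda>x y. (x, y) \<in> SC) c d \<and>
             (\<forall>e. equivclp (\<lambda>x y. (x, y) \<in> SC) c e \<and> e \<noteq> d \<longrightarrow> gt e d))"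

definition constant_rules :: "'c set \<Rightarrow> ('c \<times> 'c) set \<Rightarrow> ('c \<Rightarrow> 'c \<Rightarrow> bool) \<Rightarrow> 'c rule set" where
  "constant_rules C SC gt =
     {({#c#}, {#least_rep SC gt c#}) | c. c \<in> C \<and> c \<noteq> least_rep SC gt c}"

text \<open>\<open>interreduce \<rho> P T R T' R'\<close>: starting from \<open>T\<close> and \<open>R\<close>, the interreduction loop for the new
  rule \<open>\<rho>\<close> may end with \<open>T'\<close> and \<open>R'\<close>, where \<open>P\<close> is the set of rules the loop has still to visit.
  Both the order of the visits and the choice of normal forms are arbitrary. Normal forms are
  taken with respect to the current rule set, which contains \<open>\<rho>\<close>.\<close>

inductive interreduce ::
  "'c rule \<Rightarrow> 'c rule set \<Rightarrow> 'c equation set \<Rightarrow> 'c rule set \<Rightarrow>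
   'c equation set \<Rightarrow> 'c rule set \<Rightarrow> bool"
  for \<rho> :: "'c rule" where
  finish: "interreduce \<rho> {} T R T R"
| remove: "\<lbrakk>(l, r) \<in> P; reducible {\<rho>} l;
    interreduce \<rho> (P - {(l, r)}) (insert (l, r) T) (R - {(l, r)}) T' R'\<rbrakk>
    \<Longrightarrow> interreduce \<rho> P T R T' R'"
| simplify: "\<lbrakk>(l, r) \<in> P; \<not> reducible {\<rho>} l; rewrite {\<rho>} r s; normal_form R s r';
    interreduce \<rho> (P - {(l, r)}) T (insert (l, r') (R - {(l, r)})) T' R'\<rbrakk>
    \<Longrightarrow> interreduce \<rho> P T R T' R'"
| keep: "\<lbrakk>(l, r) \<in> P; \<not> reducible {\<rho>} l; \<not> reducible {\<rho>} r;
    interreduce \<rho> (P - {(l, r)}) T R T' R'\<rbrakk>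
    \<Longrightarrow> interreduce \<rho> P T R T' R'"

inductive orient ::
  "('c multiset \<Rightarrow> 'c multiset \<Rightarrow> bool) \<Rightarrow> 'c multiset \<Rightarrow> 'c multiset \<Rightarrow> 'c rule \<Rightarrow> bool"
  for gtf where
  "gtf l r \<Longrightarrow> orient gtf l r (l, r)"
| "gtf r l \<Longrightarrow> orient gtf l r (r, l)"

text \<open>One pass through the main loop; a state is a pair \<open>(T, R)\<close>.\<close>

inductive completion_step ::
  "('c multiset \<Rightarrow> 'c multiset \<Rightarrow> bool) \<Rightarrow>
   'c equation set \<times> 'c rule set \<Rightarrow> 'c equation set \<times> 'c rule set \<Rightarrow> bool"
  for gtf where
  discard: "\<lbrakk>(l, r) \<in> T; normal_form R l l'; normal_form R r r'; l' = r'\<rbrakk>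
    \<Longrightarrow> completion_step gtf (T, R) (T - {(l, r)}, R)"
| add_rule: "\<lbrakk>(l, r) \<in> T; normal_form R l l'; normal_form R r r'; l' \<noteq> r'; orient gtf l' r' \<rho>;
    interreduce \<rho> (R - {\<rho>}) ((T - {(l, r)}) \<union> critical_pair \<rho> ` R) (insert \<rho> R) T' R'\<rbrakk>
    \<Longrightarrow> completion_step gtf (T, R) (T', R')"

definition initial_state ::
  "'c set \<Rightarrow> ('c \<times> 'c) set \<Rightarrow> 'c equation set \<Rightarrow> ('c \<Rightarrow> 'c \<Rightarrow> bool) \<Rightarrow>
   'c equation set \<times> 'c rule set" where
  "initial_state C SC Sf gt = (Sf, constant_rules C SC gt)"

text \<open>The exit condition of the main loop. It implies \<open>T = {}\<close>, whereas a pass through the loop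
  picks an equation from \<open>T\<close>; hence no step starts in a state where the loop is left.\<close>

fun completion_finished :: "'c equation set \<times> 'c rule set \<Rightarrow> bool" where
  "completion_finished (T, R) \<longleftrightarrow>
     T = {} \<and>
     (\<forall>\<rho>\<in>R. \<forall>\<sigma>\<in>R. \<rho> \<noteq> \<sigma> \<longrightarrow>
        joinable R (fst (critical_pair \<rho> \<sigma>)) (snd (critical_pair \<rho> \<sigma>)))"

end

theory Submission
  imports Defs "HOL-Library.Infinite_Set"
begin

text \<open>A new rule has a left-hand side that is irreducible by the current rules, while
  interreduction never makes a reducible monomial irreducible: a rule is removed only when its
  left-hand side contains that of the new rule. So along infinitely many additions no left-hand
  side would contain an earlier one, against Dickson's lemma; and a run that adds no rules shrinks
  the finite set \<open>T\<close>.

  That the exit condition holds once \<open>T\<close> is exhausted follows from an invariant: the two sides of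
  every critical pair of \<open>R\<close> are connected by equations of \<open>T \<union> R\<close> through monomials strictly
  smaller than the overlap \<open>A1 \<union># B1\<close>. When \<open>T = {}\<close> this yields confluence of \<open>R\<close> by well-founded
  induction on the peak.\<close>

section \<open>Dickson's lemma for multisets\<close>

text \<open>Every tail attains a minimum, so the indices whose value is minimal on their own tail
  are unbounded; enumerating them gives the subsequence.\<close>

lemma nat_seq_mono_subseq:
  fixes f :: "nat \<Rightarrow> nat"
  obtains r :: "nat \<Rightarrow> nat" where "strict_mono r" "mono (f \<circ> r)"
proof -
  define S where "S = {i. \<forall>j\<ge>i. f i \<le> f j}"
  have "\<exists>i\<ge>n. i \<in> S" for n
  proof -
    obtain i where i: "i \<ge> n" "\<And>j. j \<ge> n \<Longrightarrow> f i \<le> f j"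
      using ex_has_least_nat[of "\<lambda>i. i \<ge> n" n f] by auto
    then show ?thesis unfolding S_def by (intro exI[of _ i]) auto
  qed
  then have inf: "infinite S" by (auto simp: infinite_nat_iff_unbounded_le)
  have "mono (f \<circ> enumerate S)"
  proof (rule monoI)
    fix x y :: nat assume "x \<le> y"
    then have "enumerate S x \<le> enumerate S y"
      using inf by (simp add: strict_mono_enumerate strict_mono_less_eq)
    then show "(f \<circ> enumerate S) x \<le> (f \<circ> enumerate S) y"
      using enumerate_in_set[OF inf, of x] by (auto simp: S_def)
  qed
  then show thesis using that strict_mono_enumerate[OF inf] by blast
qed

text \<open>Induction on \<open>C\<close>: the sequence is thinned out once per constant, and
  further thinning keeps the earlier coordinates monotone.\<close>

lemma multiset_seq_mono_subseq:
  assumes "finite C"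
  obtains r :: "nat \<Rightarrow> nat" where "strict_mono r" "\<And>c. c \<in> C \<Longrightarrow> mono (\<lambda>i. count (M (r i)) c)"
proof -
  from assms have "\<exists>r::nat \<Rightarrow> nat. strict_mono r \<and> (\<forall>c\<in>C. mono (\<lambda>i. count (M (r i)) c))"
  proof induction
    case empty
    then show ?case by (intro exI[of _ id]) (auto simp: strict_mono_def)
  next
    case (insert x F)
    then obtain r :: "nat \<Rightarrow> nat"
      where r: "strict_mono r" "\<forall>c\<in>F. mono (\<lambda>i. count (M (r i)) c)" by blast
    obtain q :: "nat \<Rightarrow> nat"
      where q: "strict_mono q" "mono ((\<lambda>i. count (M (r i)) x) \<circ> q)"
      by (rule nat_seq_mono_subseq)
    have "mono (\<lambda>i. count (M ((r \<circ> q) i)) c)" if "c \<in> insert x F" for c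
      using that r(2) q strict_mono_less_eq[OF q(1)] by (auto simp: mono_def)
    moreover have "strict_mono (r \<circ> q)" using r(1) q(1) by (simp add: strict_mono_def)
    ultimately show ?case by blast
  qed
  then show thesis using that by blast
qed

text \<open>The first two terms of a subsequence monotone in every constant are comparable;
  multiplicities outside \<open>C\<close> are zero.\<close>

lemma dickson_multiset:
  fixes M :: "nat \<Rightarrow> 'c multiset"
  assumes "finite C" and "\<And>i. set_mset (M i) \<subseteq> C"
  obtains i j where "i < j" "M i \<subseteq># M j"
proof -
  obtain r :: "nat \<Rightarrow> nat"
    where r: "strict_mono r" "\<And>c. c \<in> C \<Longrightarrow> mono (\<lambda>i. count (M (r i)) c)"
    using multiset_seq_mono_subseq[OF assms(1)] by blast
  have "count (M (r 0)) c \<le> count (M (r 1)) c" for c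
  proof (cases "c \<in> C")
    case True
    then show ?thesis using r(2)[OF True] by (auto dest: monoD)
  next
    case False
    then have "c \<notin># M (r 0)" using assms(2) by blast
    then show ?thesis by (simp add: not_in_iff)
  qed
  then have "M (r 0) \<subseteq># M (r 1)" by (simp add: subseteq_mset_def)
  moreover have "r 0 < r 1" using r(1) by (simp add: strict_mono_def)
  ultimately show thesis by (rule that[rotated])
qed


section \<open>Rewriting and bounded conversions\<close>

lemma reducible_iff: "reducible R M \<longleftrightarrow> (\<exists>(A, B)\<in>R. A \<subseteq># M)"
  unfolding reducible_def rewrite_def by auto

text \<open>The overlap is the pointwise maximum of the left-hand sides, the least multiset that
  contains both.\<close>

lemma critical_pair_eq:
  "critical_pair (A1, A2) (B1, B2) =
     ((A1 \<union># B1 - A1) + A2, (A1 \<union># B1 - B1) + B2)"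
proof -
  have "A1 + B1 - (A1 \<inter># B1) = A1 \<union># B1"
    by (rule multiset_eqI) (auto simp: min_def max_def)
  then show ?thesis by (simp only: critical_pair.simps Let_def)
qed

text \<open>An explicit context \<open>K\<close> in place of a truncated difference makes stability
  under addition a matter of associativity.\<close>

definition equation_step :: "'c equation set \<Rightarrow> 'c multiset \<Rightarrow> 'c multiset \<Rightarrow> bool" where
  "equation_step E M N \<longleftrightarrow> (\<exists>A B K. (A, B) \<in> E \<and> M = A + K \<and> N = B + K)"

text \<open>Every monomial of a nontrivial chain lies in \<open>S\<close>; the trivial chain is not restricted.\<close>

definition conversion ::
  "'c equation set \<Rightarrow> 'c multiset set \<Rightarrow> 'c multiset \<Rightarrow> 'c multiset \<Rightarrow> bool" where
  "conversion E S =
     (\<lambda>M N. M \<in> S \<and> N \<in> S \<and> (equation_step E M N \<or> equation_step E N M))\<^sup>*\<^sup>*"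

lemma rewrite_equation_step: "rewrite R M N \<longleftrightarrow> equation_step R M N"
  unfolding rewrite_def equation_step_def
  by (metis add.commute add_diff_cancel_left' mset_subset_eq_add_left subset_mset.diff_add)

lemma rewrite_mono: "R \<subseteq> R' \<Longrightarrow> rewrite R M N \<Longrightarrow> rewrite R' M N"
  unfolding rewrite_def by blast

lemma conversion_refl [simp]: "conversion E S M M"
  by (simp add: conversion_def)

lemma conversion_trans: "conversion E S L M \<Longrightarrow> conversion E S M N \<Longrightarrow> conversion E S L N"
  unfolding conversion_def by (rule rtranclp_trans)

lemma conversion_sym: "conversion E S M N \<Longrightarrow> conversion E S N M"
  unfolding conversion_def
  by (induction rule: rtranclp_induct) (auto intro: converse_rtranclp_into_rtranclp)

lemma conversion_step:
  "(A, B) \<in> E \<Longrightarrow> A + K \<in> S \<Longrightarrow> B + K \<in> S \<Longrightarrow> conversion E S (A + K) (B + K)"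
  unfolding conversion_def equation_step_def by (intro r_into_rtranclp) auto

lemma conversion_mono:
  "conversion E S M N \<Longrightarrow> E \<subseteq> E' \<Longrightarrow> S \<subseteq> S' \<Longrightarrow> conversion E' S' M N"
  unfolding conversion_def
  by (erule rtranclp_mono[THEN predicate2D, rotated]) (unfold equation_step_def, blast)

text \<open>The bounding set is shifted along with the chain; \<open>S'\<close> is typically a bound
  given by a larger monomial.\<close>

lemma conversion_add:
  assumes "conversion E S M N" and "\<And>L. L \<in> S \<Longrightarrow> L + K \<in> S'"
  shows "conversion E S' (M + K) (N + K)"
  using assms(1) unfolding conversion_def
proof induction
  case (step N N')
  have add: "equation_step E (X + K) (Y + K)" if "equation_step E X Y" for X Y
    using that unfolding equation_step_def by (metis add.assoc)
  from step show ?case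
    by (elim rtranclp.rtrancl_into_rtrancl) (auto intro: add assms(2))
qed simp


section \<open>Admissible orderings\<close>

locale admissible_order =
  fixes C :: "'c set" and gt :: "'c \<Rightarrow> 'c \<Rightarrow> bool"
    and gtf :: "'c multiset \<Rightarrow> 'c multiset \<Rightarrow> bool"
  assumes admissible: "admissible C gt gtf"
begin

text \<open>Admissibility speaks of monomials over \<open>C\<close> only; the restriction makes
  transitivity and well-foundedness hold on all multisets.\<close>

definition less_mono :: "'c multiset \<Rightarrow> 'c multiset \<Rightarrow> bool"  (infix "\<prec>" 50) where
  "M \<prec> N \<longleftrightarrow> M \<in> monomials C \<and> N \<in> monomials C \<and> gtf N M"

definition below :: "'c multiset \<Rightarrow> 'c multiset set" where
  "below M = {N. N \<prec> M}"

text \<open>The strict bound \<open>below\<close> serves for peaks, this reflexive one for chains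
  that start at \<open>M\<close> itself.\<close>

definition down :: "'c multiset \<Rightarrow> 'c multiset set" where
  "down M = insert M (below M)"

lemma less_monoD: "M \<prec> N \<Longrightarrow> M \<in> monomials C" "M \<prec> N \<Longrightarrow> N \<in> monomials C"
  by (auto simp: less_mono_def)

lemma less_mono_irrefl: "\<not> M \<prec> M"
  using admissible
  by (auto simp: less_mono_def admissible_def strict_total_order_on_def dest: irreflp_onD)

lemma less_mono_trans: "L \<prec> M \<Longrightarrow> M \<prec> N \<Longrightarrow> L \<prec> N"
  using admissible
  by (auto simp: less_mono_def admissible_def strict_total_order_on_def dest: transp_onD)

lemma less_mono_total:
  "M \<in> monomials C \<Longrightarrow> N \<in> monomials C \<Longrightarrow> M \<noteq> N \<Longrightarrow> M \<prec> N \<or> N \<prec> M"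
  using admissible
  by (auto simp: less_mono_def admissible_def strict_total_order_on_def dest: totalp_onD)

text \<open>Multisets that are not monomials are isolated, so a minimal element is sought among the
  monomials of a set whenever it has any.\<close>

lemma wfp_less_mono: "wfp (\<prec>)"
proof -
  have "wfp_on (monomials C) (\<lambda>M N. gtf N M)"
    using admissible by (auto simp: admissible_def)
  then have *: "\<exists>z\<in>B. \<forall>y. gtf z y \<longrightarrow> y \<notin> B" if "B \<subseteq> monomials C" "B \<noteq> {}" for B
    using that unfolding wfp_on_iff_ex_minimal by blast
  show ?thesis unfolding wfp_iff_ex_minimal
  proof (intro allI impI)
    fix B :: "'c multiset set" assume B: "B \<noteq> {}"
    show "\<exists>z\<in>B. \<forall>y. y \<prec> z \<longrightarrow> y \<notin> B"
    proof (cases "B \<inter> monomials C = {}")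
      case True
      then show ?thesis using B less_monoD by blast
    next
      case False
      then show ?thesis using *[of "B \<inter> monomials C"] by (auto simp: less_mono_def)
    qed
  qed
qed

lemma monomials_add: "M \<in> monomials C \<Longrightarrow> set_mset K \<subseteq> C \<Longrightarrow> M + K \<in> monomials C"
  by (auto simp: monomials_def)

lemma less_mono_add: "M \<prec> N \<Longrightarrow> set_mset K \<subseteq> C \<Longrightarrow> M + K \<prec> N + K"
  using admissible unfolding less_mono_def by (auto simp: admissible_def monomials_add)

lemma less_mono_subset: "M \<subset># N \<Longrightarrow> M \<in> monomials C \<Longrightarrow> N \<in> monomials C \<Longrightarrow> M \<prec> N"
  using admissible unfolding less_mono_def by (auto simp: admissible_def)

lemma less_mono_singleton: "gt c d \<Longrightarrow> c \<in> C \<Longrightarrow> d \<in> C \<Longrightarrow> {#d#} \<prec> {#c#}"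
  using admissible unfolding less_mono_def by (auto simp: admissible_def monomials_def)

text \<open>Sub-multisets are never larger in the ordering. Hence a rule does not apply to a
  monomial below its left-hand side.\<close>

lemma not_subset_if_less: "M \<prec> N \<Longrightarrow> \<not> N \<subseteq># M"
  using less_mono_subset[of N M] less_mono_trans less_mono_irrefl less_monoD
  by (metis subset_mset.le_neq_trans)

lemma below_down_closed: "M \<in> below X \<Longrightarrow> down M \<subseteq> below X"
  by (auto simp: below_def down_def intro: less_mono_trans)

lemma down_down_closed: "M \<in> down X \<Longrightarrow> down M \<subseteq> down X"
  by (auto simp: below_def down_def intro: less_mono_trans)

section \<open>Oriented rule sets and descending rewriting\<close>

definition oriented :: "'c rule set \<Rightarrow> bool" where
  "oriented R \<longleftrightarrow> (\<forall>(A, B)\<in>R. B \<prec> A)"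

lemma orientedD: "oriented R \<Longrightarrow> (A, B) \<in> R \<Longrightarrow> B \<prec> A"
  by (auto simp: oriented_def)

lemma rewrite_less:
  assumes "oriented R" "rewrite R M N" "M \<in> monomials C"
  shows "N \<prec> M"
proof -
  from assms(2) obtain A B K where AB: "(A, B) \<in> R" "M = A + K" "N = B + K"
    unfolding rewrite_equation_step equation_step_def by blast
  then have "set_mset K \<subseteq> C" using assms(3) by (auto simp: monomials_def)
  then show ?thesis using AB orientedD[OF assms(1)] less_mono_add by blast
qed

text \<open>Each step descends, so the whole chain stays in \<open>down M\<close>.\<close>

lemma rewrites_conversion:
  assumes "oriented R" "(rewrite R)\<^sup>*\<^sup>* M N" "M \<in> monomials C" "R \<subseteq> E"
  shows "N \<in> down M \<and> conversion E (down M) M N"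
  using assms(2)
proof induction
  case base
  then show ?case by (simp add: down_def)
next
  case (step N N')
  then have "N \<in> monomials C" using assms(3) by (auto simp: down_def below_def dest: less_monoD)
  then have "N' \<prec> N" using rewrite_less assms(1) step by blast
  then have N': "N' \<in> down M"
    using step by (auto simp: down_def below_def intro: less_mono_trans)
  have "equation_step E N N'"
    using step(2) assms(4) unfolding rewrite_equation_step equation_step_def by blast
  then have "conversion E (down M) N N'"
    using N' step unfolding equation_step_def by (auto intro: conversion_step)
  then show ?case using N' step conversion_trans by blast
qed

lemma normal_form_exists:
  assumes "oriented R" "M \<in> monomials C"
  obtains N where "normal_form R M N"
proof -
  have "\<exists>N. normal_form R M N" using assms(2)
  proof (induction M rule: wfp_induct_rule[OF wfp_less_mono])
    case (1 M)
    show ?case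
    proof (cases "reducible R M")
      case True
      then obtain N where N: "rewrite R M N" unfolding reducible_def by blast
      then have "N \<prec> M" using rewrite_less assms(1) 1 by blast
      then obtain N' where "normal_form R N N'" using 1 less_monoD by blast
      then show ?thesis using N unfolding normal_form_def
        by (meson converse_rtranclp_into_rtranclp)
    next
      case False
      then show ?thesis unfolding normal_form_def by blast
    qed
  qed
  then show thesis using that by blast
qed

lemma normal_form_monomial:
  "oriented R \<Longrightarrow> normal_form R M N \<Longrightarrow> M \<in> monomials C \<Longrightarrow> N \<in> monomials C"
  using rewrites_conversion[of R M N UNIV]
  by (auto simp: normal_form_def down_def below_def dest: less_monoD)

text \<open>Interreduction normalizes the right-hand side of \<open>l \<rightarrow> r\<close> while this rule is still
  present; it cannot be applied, as all reducts of \<open>r\<close> are smaller than \<open>l\<close>.\<close>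

lemma rewrites_avoid_rule:
  assumes "oriented R" "(rewrite R)\<^sup>*\<^sup>* M N" "M \<prec> l"
  shows "(rewrite (R - {(l, r)}))\<^sup>*\<^sup>* M N"
  using assms(2)
proof induction
  case (step N N')
  then have "N \<in> down M"
    using rewrites_conversion[OF assms(1) _ less_monoD(1)[OF assms(3)] subset_UNIV] by blast
  then have "N \<prec> l" using assms(3) by (auto simp: down_def below_def intro: less_mono_trans)
  then have "rewrite (R - {(l, r)}) N N'"
    using step(2) not_subset_if_less unfolding rewrite_def by blast
  then show ?case using step by simp
qed simp

section \<open>Connected peaks under changes of equations and rules\<close>

text \<open>A step by an equation of \<open>E\<close> is simulated by the chain for that equation,
  shifted by the context. Compatibility with addition keeps this chain under the two ends of the
  step, and the downward closed \<open>S\<close> absorbs it.\<close>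

lemma conversion_replace:
  assumes E: "\<And>A B. (A, B) \<in> E \<Longrightarrow> conversion E' (down A \<union> down B) A B"
    and S: "S \<subseteq> monomials C" "\<And>M. M \<in> S \<Longrightarrow> down M \<subseteq> S"
    and conv: "conversion E S M N"
  shows "conversion E' S M N"
proof -
  have one: "conversion E' S M N" if MN: "M \<in> S" "N \<in> S" "equation_step E M N" for M N
  proof -
    from MN(3) obtain A B K where AB: "(A, B) \<in> E" "M = A + K" "N = B + K"
      unfolding equation_step_def by blast
    have K: "set_mset K \<subseteq> C" using AB(2) MN(1) S(1) by (force simp: monomials_def)
    have "conversion E' (down M \<union> down N) (A + K) (B + K)"
      using E[OF AB(1)]
    proof (rule conversion_add)
      fix L assume "L \<in> down A \<union> down B"
      then show "L + K \<in> down M \<union> down N"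
        using less_mono_add[OF _ K] by (auto simp: AB down_def below_def)
    qed
    then show ?thesis using AB S(2) MN by (auto intro: conversion_mono)
  qed
  from conv show ?thesis unfolding conversion_def[of E]
  proof induction
    case (step N N')
    then have "conversion E' S N N'" using one conversion_sym by blast
    then show ?case using step conversion_trans by blast
  qed simp
qed

text \<open>Connectedness below the overlap, in the sense of Winkler and Buchberger. For oriented
  rules it is weaker than joinability of the critical pair, and it survives changes of the rules as
  long as lost equations are replaced by bounded chains.\<close>

definition peak_connected :: "'c equation set \<Rightarrow> 'c rule \<Rightarrow> 'c rule \<Rightarrow> bool" where
  "peak_connected E \<rho> \<sigma> \<longleftrightarrow>
     conversion E (below (fst \<rho> \<union># fst \<sigma>))
       (fst (critical_pair \<rho> \<sigma>)) (snd (critical_pair \<rho> \<sigma>))"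

lemma peak_connected_refl: "peak_connected E \<rho> \<rho>"
  by (cases \<rho>) (simp add: peak_connected_def critical_pair_eq)

lemma peak_connected_sym: "peak_connected E \<rho> \<sigma> \<Longrightarrow> peak_connected E \<sigma> \<rho>"
  by (cases \<rho>; cases \<sigma>)
    (simp only: peak_connected_def critical_pair_eq fst_conv snd_conv subset_mset.sup_commute
      conversion_sym)

lemma union_diff_less:
  assumes "B \<prec> A" "set_mset M \<subseteq> C" "A \<subseteq># M"
  shows "M - A + B \<prec> M"
proof -
  have "B + (M - A) \<prec> A + (M - A)"
    using assms by (intro less_mono_add) (auto dest: in_diffD)
  then show ?thesis using assms(3) by (simp add: add.commute)
qed

text \<open>Both sides are one-step reducts of the overlap.\<close>

lemma critical_pair_below:
  assumes "A2 \<prec> A1" "B2 \<prec> B1"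
  shows "(A1 \<union># B1 - A1) + A2 \<prec> A1 \<union># B1" "(A1 \<union># B1 - B1) + B2 \<prec> A1 \<union># B1"
proof -
  have "set_mset (A1 \<union># B1) \<subseteq> C"
    using assms[THEN less_monoD(2)] by (simp add: monomials_def)
  then show "(A1 \<union># B1 - A1) + A2 \<prec> A1 \<union># B1" "(A1 \<union># B1 - B1) + B2 \<prec> A1 \<union># B1"
    using assms by (blast intro: union_diff_less subset_mset.sup_ge1 subset_mset.sup_ge2)+
qed

text \<open>New right-hand sides move the two ends of the critical pair along chains that stay
  strictly below the overlap, because the old right-hand sides are below their left-hand
  sides.\<close>

lemma peak_connected_rhs:
  assumes peak: "peak_connected E (A1, A2) (B1, B2)"
    and less: "A2 \<prec> A1" "B2 \<prec> B1"
    and A: "conversion E (down A2) A2 A2'" and B: "conversion E (down B2) B2 B2'"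
  shows "peak_connected E (A1, A2') (B1, B2')"
proof -
  define X where "X = A1 \<union># B1"
  \<comment> \<open>Here \<open>L\<close> is one of the two left-hand sides, \<open>R\<close> its
    old and \<open>R'\<close> its new right-hand side.\<close>
  have aux: "conversion E (below X) (X - L + R) (X - L + R')"
    if "R \<prec> L" "L \<subseteq># X" "conversion E (down R) R R'" for L R R'
  proof -
    have X: "set_mset X \<subseteq> C"
      using less[THEN less_monoD(2)] by (auto simp: X_def monomials_def)
    have "conversion E (below X) (R + (X - L)) (R' + (X - L))"
      using that(3)
    proof (rule conversion_add)
      fix K assume "K \<in> down R"
      then have "K \<prec> L" using that(1) by (auto simp: down_def below_def intro: less_mono_trans)
      then show "K + (X - L) \<in> below X"
        using union_diff_less[OF _ X that(2)] by (simp add: below_def add.commute)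
    qed
    then show ?thesis by (simp add: add.commute)
  qed
  have "conversion E (below X) (X - A1 + A2) (X - B1 + B2)"
    using peak by (simp only: peak_connected_def critical_pair_eq X_def fst_conv snd_conv)
  moreover have "conversion E (below X) (X - A1 + A2) (X - A1 + A2')"
    using less A by (intro aux) (auto simp: X_def)
  moreover have "conversion E (below X) (X - B1 + B2) (X - B1 + B2')"
    using less B by (intro aux) (auto simp: X_def)
  ultimately have "conversion E (below X) (X - A1 + A2') (X - B1 + B2')"
    using conversion_sym conversion_trans by blast
  then show ?thesis by (simp only: peak_connected_def critical_pair_eq X_def fst_conv snd_conv)
qed

lemma peak_connected_replace:
  assumes "\<And>A B. (A, B) \<in> E \<Longrightarrow> conversion E' (down A \<union> down B) A B"
    and "peak_connected E \<rho> \<sigma>"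
  shows "peak_connected E' \<rho> \<sigma>"
  using assms(2) unfolding peak_connected_def
  by (rule conversion_replace[rotated -1])
    (use assms(1) below_down_closed less_monoD in \<open>auto simp: below_def\<close>)


section \<open>Connected critical pairs imply confluence\<close>

text \<open>As in Newman's lemma, induction on the source of the divergence; a one-step peak is
  closed not by joinability but by a chain of smaller monomials, which the induction hypothesis
  collapses.\<close>

lemma peak_connected_imp_confluent:
  assumes R: "oriented R" and peaks: "\<And>\<rho> \<sigma>. \<rho> \<in> R \<Longrightarrow> \<sigma> \<in> R \<Longrightarrow> peak_connected R \<rho> \<sigma>"
    and X: "X \<in> monomials C"
    and "(rewrite R)\<^sup>*\<^sup>* X M" "(rewrite R)\<^sup>*\<^sup>* X N"
  shows "joinable R M N"
  using X assms(4,5)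
proof (induction X arbitrary: M N rule: wfp_induct_rule[OF wfp_less_mono])
  case (1 X)
  have IH: "joinable R M N" if "Y \<prec> X" "(rewrite R)\<^sup>*\<^sup>* Y M" "(rewrite R)\<^sup>*\<^sup>* Y N" for Y M N
    using 1(1) that less_monoD by blast
  \<comment> \<open>The Church-Rosser property below \<open>X\<close>, by induction along the chain.
    Only a forward step needs the induction hypothesis, at its source.\<close>
  have conv: "joinable R M N" if "conversion R (below X) M N" "M \<in> below X" for M N
    using that(1) unfolding conversion_def
  proof induction
    case base
    then show ?case unfolding joinable_def by blast
  next
    case (step N N')
    then obtain K where K: "(rewrite R)\<^sup>*\<^sup>* M K" "(rewrite R)\<^sup>*\<^sup>* N K"
      unfolding joinable_def by blast
    from step(2) consider "rewrite R N N'" | "rewrite R N' N"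
      unfolding rewrite_equation_step by blast
    then show ?case
    proof cases
      case 1
      then have "joinable R K N'" using IH[of N K N'] K step(2) by (auto simp: below_def)
      then show ?thesis using K unfolding joinable_def by (meson rtranclp_trans)
    next
      case 2
      then show ?thesis using K unfolding joinable_def
        by (meson converse_rtranclp_into_rtranclp)
    qed
  qed
  show ?case
  proof (cases "X = M \<or> X = N")
    case True
    then show ?thesis using 1 unfolding joinable_def by blast
  next
    case False
    then obtain M1 N1 where M1: "rewrite R X M1" "(rewrite R)\<^sup>*\<^sup>* M1 M"
      and N1: "rewrite R X N1" "(rewrite R)\<^sup>*\<^sup>* N1 N"
      using 1(3,4) by (metis converse_rtranclpE)
    have less: "M1 \<prec> X" "N1 \<prec> X" using rewrite_less R 1(2) M1 N1 by blast+
    obtain A1 A2 where A: "(A1, A2) \<in> R" "A1 \<subseteq># X" "M1 = X - A1 + A2"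
      using M1(1) unfolding rewrite_def by blast
    obtain B1 B2 where B: "(B1, B2) \<in> R" "B1 \<subseteq># X" "N1 = X - B1 + B2"
      using N1(1) unfolding rewrite_def by blast
    \<comment> \<open>The peak at \<open>X\<close> is the critical peak at \<open>U\<close> in the
      context \<open>X - U\<close>. Disjoint left-hand sides need no separate case, as critical
      pairs are formed for them too.\<close>
    define U where "U = A1 \<union># B1"
    have U: "U \<subseteq># X" "A1 \<subseteq># U" "B1 \<subseteq># U" using A(2) B(2) by (auto simp: U_def)
    have split: "X - L + L' = (U - L + L') + (X - U)" if "L \<subseteq># U" for L L'
    proof (rule multiset_eqI)
      fix x
      have "count L x \<le> count U x" "count U x \<le> count X x"
        using U(1) that by (auto intro: mset_subset_eq_count)
      then show "count (X - L + L') x = count ((U - L + L') + (X - U)) x" by simp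
    qed
    have "conversion R (below X) ((U - A1 + A2) + (X - U)) ((U - B1 + B2) + (X - U))"
    proof (rule conversion_add)
      show "conversion R (below U) (U - A1 + A2) (U - B1 + B2)"
        using peaks[OF A(1) B(1)] by (simp only: peak_connected_def critical_pair_eq U_def fst_conv snd_conv)
      fix L assume "L \<in> below U"
      then have "L + (X - U) \<prec> U + (X - U)"
        using 1(2) by (intro less_mono_add) (auto simp: below_def monomials_def dest: in_diffD)
      then show "L + (X - U) \<in> below X" using U(1) by (simp add: below_def)
    qed
    then have "conversion R (below X) M1 N1" unfolding A(3) B(3) split[OF U(2)] split[OF U(3)] .
    then obtain K where K: "(rewrite R)\<^sup>*\<^sup>* M1 K" "(rewrite R)\<^sup>*\<^sup>* N1 K"
      using conv less unfolding below_def joinable_def by blast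
    \<comment> \<open>The induction hypothesis at \<open>M1\<close> joins \<open>M\<close> with
      \<open>K\<close>; at \<open>N1\<close> it then joins the result with \<open>N\<close>.\<close>
    obtain L where L: "(rewrite R)\<^sup>*\<^sup>* M L" "(rewrite R)\<^sup>*\<^sup>* K L"
      using IH[OF less(1) M1(2) K(1)] unfolding joinable_def by blast
    have "(rewrite R)\<^sup>*\<^sup>* N1 L" using K(2) L(2) by (rule rtranclp_trans)
    then obtain L' where "(rewrite R)\<^sup>*\<^sup>* L L'" "(rewrite R)\<^sup>*\<^sup>* N L'"
      using IH[OF less(2) _ N1(2)] unfolding joinable_def by blast
    then show ?thesis using L unfolding joinable_def by (meson rtranclp_trans)
  qed
qed


section \<open>The completion invariant\<close>

text \<open>Finiteness of \<open>T\<close> bounds runs of discarding passes; finiteness of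
  \<open>R\<close> lets interreduction visit every rule.\<close>

definition invariant :: "'c equation set \<Rightarrow> 'c rule set \<Rightarrow> bool" where
  "invariant T R \<longleftrightarrow> finite T \<and> finite R \<and> T \<subseteq> monomials C \<times> monomials C \<and> oriented R \<and>
     (\<forall>\<rho>\<in>R. \<forall>\<sigma>\<in>R. peak_connected (T \<union> R) \<rho> \<sigma>)"

lemma conversion_equation:
  "(A, B) \<in> E \<Longrightarrow> conversion E (down A \<union> down B) A B"
  using conversion_step[of A B E "{#}"] by (simp add: down_def)

text \<open>Without pending equations the rules alone connect all peaks, so rewriting is confluent;
  the overlap rewrites to both sides of the critical pair.\<close>

lemma invariant_finished:
  assumes "invariant {} R"
  shows "completion_finished ({}, R)"
proof -
  have R: "oriented R" "\<And>\<rho> \<sigma>. \<rho> \<in> R \<Longrightarrow> \<sigma> \<in> R \<Longrightarrow> peak_connected R \<rho> \<sigma>"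
    using assms by (auto simp: invariant_def)
  have "joinable R (fst (critical_pair \<rho> \<sigma>)) (snd (critical_pair \<rho> \<sigma>))"
    if \<rho>\<sigma>: "\<rho> \<in> R" "\<sigma> \<in> R" for \<rho> \<sigma>
  proof -
    obtain A1 A2 B1 B2 where eq: "\<rho> = (A1, A2)" "\<sigma> = (B1, B2)" by force
    define X where "X = A1 \<union># B1"
    have "A2 \<prec> A1" "B2 \<prec> B1" using orientedD[OF R(1)] \<rho>\<sigma> eq by auto
    then have "X \<in> monomials C" using critical_pair_below less_monoD(2) unfolding X_def by blast
    moreover have "rewrite R X (X - A1 + A2)" "rewrite R X (X - B1 + B2)"
      unfolding rewrite_def using \<rho>\<sigma> eq
      by (metis X_def subset_mset.sup_ge1, metis X_def subset_mset.sup_ge2)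
    ultimately have "joinable R (X - A1 + A2) (X - B1 + B2)"
      using peak_connected_imp_confluent[OF R] by blast
    then show ?thesis by (simp only: eq critical_pair_eq X_def fst_conv snd_conv)
  qed
  then show ?thesis by simp
qed

text \<open>The union of \<open>T\<close> and \<open>R\<close> stays the same, so all connecting
  chains persist.\<close>

lemma invariant_remove:
  assumes "invariant T R" "(l, r) \<in> R"
  shows "invariant (insert (l, r) T) (R - {(l, r)})"
proof -
  have "insert (l, r) T \<union> (R - {(l, r)}) = T \<union> R" using assms(2) by blast
  then show ?thesis using assms unfolding invariant_def oriented_def
    by (auto dest: less_monoD)
qed

text \<open>The lost equation is recovered through \<open>r'\<close>: the new rule leads from
  \<open>l\<close> to \<open>r'\<close>, and the other rules rewrite \<open>r\<close> to
  \<open>r'\<close>. Left-hand sides, hence overlaps, do not change.\<close>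

lemma invariant_simplify:
  assumes inv: "invariant T R" and lr: "(l, r) \<in> R" and red: "(rewrite R)\<^sup>*\<^sup>* r r'"
  shows "invariant T (insert (l, r') (R - {(l, r)}))"
proof -
  let ?R = "insert (l, r') (R - {(l, r)})"
  let ?E = "T \<union> ?R"
  have R: "oriented R" using inv by (simp add: invariant_def)
  have rl: "r \<prec> l" using orientedD R lr by blast
  have R0: "oriented (R - {(l, r)})" using R by (auto simp: oriented_def)
  have "(rewrite (R - {(l, r)}))\<^sup>*\<^sup>* r r'" using rewrites_avoid_rule[OF R red rl] .
  then have r': "r' \<in> down r" "conversion ?E (down r) r r'"
    using rewrites_conversion[OF R0 _ less_monoD(1)[OF rl], of r' ?E] by auto
  have r'l: "r' \<prec> l" using r'(1) rl by (auto simp: down_def below_def intro: less_mono_trans)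
  have replace: "conversion ?E (down A \<union> down B) A B" if "(A, B) \<in> T \<union> R" for A B
  proof (cases "(A, B) = (l, r)")
    case True
    have "conversion ?E (down l \<union> down r) l r'"
      using conversion_equation[of l r' ?E] down_down_closed[OF r'(1)]
      by (auto intro: conversion_mono)
    moreover have "conversion ?E (down l \<union> down r) r' r"
      using r'(2) by (blast intro: conversion_sym conversion_mono)
    ultimately show ?thesis using True conversion_trans by blast
  next
    case False
    then show ?thesis using that by (intro conversion_equation) auto
  qed
  \<comment> \<open>Each new rule is traced back to an old one with the same left-hand side, as
    \<open>peak_connected_rhs\<close> requires.\<close>
  have old: "\<exists>B0. (A, B0) \<in> R \<and> conversion ?E (down B0) B0 B" if "(A, B) \<in> ?R" for A B
    using that lr r'(2) conversion_refl by blast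
  have "peak_connected ?E \<rho> \<sigma>" if \<rho>\<sigma>: "\<rho> \<in> ?R" "\<sigma> \<in> ?R" for \<rho> \<sigma>
  proof -
    obtain A1 A2 B1 B2 where eq: "\<rho> = (A1, A2)" "\<sigma> = (B1, B2)" by force
    obtain A0 where A0: "(A1, A0) \<in> R" "conversion ?E (down A0) A0 A2"
      using old \<rho>\<sigma>(1) eq by blast
    obtain B0 where B0: "(B1, B0) \<in> R" "conversion ?E (down B0) B0 B2"
      using old \<rho>\<sigma>(2) eq by blast
    have "peak_connected (T \<union> R) (A1, A0) (B1, B0)"
      using inv A0(1) B0(1) by (simp add: invariant_def)
    then have "peak_connected ?E (A1, A0) (B1, B0)"
      using peak_connected_replace replace by blast
    then show ?thesis unfolding eq
      using A0 B0 orientedD[OF R] peak_connected_rhs by blast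
  qed
  then show ?thesis using inv r'l R0 by (auto simp: invariant_def oriented_def)
qed

section \<open>The interreduction loop\<close>

text \<open>Whatever a removed rule reduces, \<open>\<rho>\<close> reduces too, and
  \<open>\<rho>\<close> itself survives because it is never visited. Simplification leaves left-hand
  sides alone.\<close>

lemma interreduce_invariant:
  assumes "interreduce \<rho> P T R T' R'"
    and "invariant T R" "P \<subseteq> R" "\<rho> \<in> R" "\<rho> \<notin> P"
  shows "invariant T' R' \<and> (\<forall>M. reducible R M \<longrightarrow> reducible R' M)"
  using assms
proof induction
  case (finish T R)
  then show ?case by blast
next
  case (remove l r P T R T' R')
  obtain A B where \<rho>: "\<rho> = (A, B)" by force
  have "A \<subseteq># l" using remove(2) by (simp add: reducible_iff \<rho>)
  moreover have "(A, B) \<in> R - {(l, r)}" using remove \<rho> by blast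
  ultimately have "reducible (R - {(l, r)}) M" if "reducible R M" for M
    using that unfolding reducible_iff by (auto intro: subset_mset.order_trans)
  moreover have "invariant (insert (l, r) T) (R - {(l, r)})"
    using remove invariant_remove by blast
  ultimately show ?case using remove by blast
next
  case (simplify l r P s R r' T T' R')
  have "rewrite R r s" using simplify(3) rewrite_mono[of "{\<rho>}" R] simplify.prems by blast
  then have "(rewrite R)\<^sup>*\<^sup>* r r'" using simplify(4) unfolding normal_form_def
    by (meson converse_rtranclp_into_rtranclp)
  then have "invariant T (insert (l, r') (R - {(l, r)}))"
    using simplify invariant_simplify by blast
  moreover have "reducible (insert (l, r') (R - {(l, r)})) M" if "reducible R M" for M
    using that unfolding reducible_iff by auto
  ultimately show ?case using simplify by blast
next
  case (keep l r P R T T' R')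
  then show ?case by blast
qed

text \<open>Ensures that the loop can always be completed, so that no pass gets stuck in the middle;
  normal forms exist by well-foundedness.\<close>

lemma interreduce_total:
  assumes "finite P" "invariant T R" "P \<subseteq> R" "\<rho> \<in> R" "\<rho> \<notin> P"
  shows "\<exists>T' R'. interreduce \<rho> P T R T' R'"
  using assms
proof (induction P arbitrary: T R rule: finite_induct)
  case empty
  then show ?case using interreduce.finish by blast
next
  case (insert x P)
  obtain l r where x: "x = (l, r)" by force
  have P: "insert x P - {(l, r)} = P" "(l, r) \<in> insert x P" "(l, r) \<in> R"
    using insert x by auto
  have R: "oriented R" using insert.prems by (simp add: invariant_def)
  consider "reducible {\<rho>} l" | s where "\<not> reducible {\<rho>} l" "rewrite {\<rho>} r s"
    | "\<not> reducible {\<rho>} l" "\<not> reducible {\<rho>} r"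
    unfolding reducible_def by blast
  then show ?case
  proof cases
    case 1
    have "invariant (insert (l, r) T) (R - {(l, r)})"
      using insert.prems P invariant_remove by blast
    then have "\<exists>T' R'. interreduce \<rho> P (insert (l, r) T) (R - {(l, r)}) T' R'"
      using insert x by (intro insert.IH) auto
    then show ?thesis using interreduce.remove[OF P(2) 1] P(1) by metis
  next
    case 2
    have rs: "rewrite R r s" using 2(2) rewrite_mono[of "{\<rho>}" R] insert.prems by blast
    have "r \<in> monomials C" using orientedD[OF R] P(3) less_monoD by blast
    then have "s \<in> monomials C" using rewrite_less[OF R rs] less_monoD by blast
    then obtain r' where r': "normal_form R s r'" using normal_form_exists[OF R] by blast
    then have "(rewrite R)\<^sup>*\<^sup>* r r'" using rs unfolding normal_form_def
      by (meson converse_rtranclp_into_rtranclp)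
    then have "invariant T (insert (l, r') (R - {(l, r)}))"
      by (rule invariant_simplify[OF insert.prems(1) P(3)])
    then have "\<exists>T' R'. interreduce \<rho> P T (insert (l, r') (R - {(l, r)})) T' R'"
      using insert x by (intro insert.IH) auto
    then show ?thesis using interreduce.simplify[OF P(2) 2 r'] P(1) by metis
  next
    case 3
    have "\<exists>T' R'. interreduce \<rho> P T R T' R'"
      using insert by (intro insert.IH) auto
    then show ?thesis using interreduce.keep[OF P(2) 3] P(1) by metis
  qed
qed

section \<open>Passes through the main loop\<close>

text \<open>Recovers an equation taken out of \<open>T\<close>: its sides descend to their normal
  forms, which coincide or are related by the new rule.\<close>

lemma normal_forms_conversion:
  assumes R: "oriented R" "R \<subseteq> E" and mono: "l \<in> monomials C" "r \<in> monomials C"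
    and nf: "normal_form R l l'" "normal_form R r r'"
    and E: "conversion E (down l' \<union> down r') l' r'"
  shows "conversion E (down l \<union> down r) l r"
proof -
  have l: "l' \<in> down l" "conversion E (down l) l l'"
    and r: "r' \<in> down r" "conversion E (down r) r r'"
    using rewrites_conversion[OF R(1) _ mono(1) R(2)] rewrites_conversion[OF R(1) _ mono(2) R(2)] nf
    unfolding normal_form_def by blast+
  let ?S = "down l \<union> down r"
  have "conversion E ?S l l'" "conversion E ?S r' r"
    using l r by (blast intro: conversion_mono conversion_sym)+
  moreover have "conversion E ?S l' r'"
    using E by (rule conversion_mono) (use l r down_down_closed in blast)+
  ultimately show ?thesis using conversion_trans by blast
qed

lemma invariant_discard:
  assumes inv: "invariant T R" and lr: "(l, r) \<in> T"
    and nf: "normal_form R l l'" "normal_form R r l'"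
  shows "invariant (T - {(l, r)}) R"
proof -
  let ?E = "T - {(l, r)} \<union> R"
  have R: "oriented R" and mono: "l \<in> monomials C" "r \<in> monomials C"
    using inv lr by (auto simp: invariant_def)
  have "conversion ?E (down l \<union> down r) l r"
    using normal_forms_conversion[OF R _ mono nf] by auto
  then have "conversion ?E (down A \<union> down B) A B" if "(A, B) \<in> T \<union> R" for A B
    using that by (cases "(A, B) = (l, r)") (auto intro: conversion_equation)
  then have "peak_connected ?E \<rho> \<sigma>" if "\<rho> \<in> R" "\<sigma> \<in> R" for \<rho> \<sigma>
    using inv that peak_connected_replace unfolding invariant_def by blast
  then show ?thesis using inv by (auto simp: invariant_def)
qed

text \<open>Old peaks survive because the new rule replaces the equation picked; peaks between
  \<open>\<rho>\<close> and old rules are connected by the critical pairs just put into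
  \<open>T\<close>.\<close>

lemma invariant_add:
  assumes inv: "invariant T R" and lr: "(l, r) \<in> T"
    and nf: "normal_form R l l'" "normal_form R r r'"
    and orient: "orient gtf l' r' \<rho>"
  shows "invariant (T - {(l, r)} \<union> critical_pair \<rho> ` R) (insert \<rho> R)"
    and "fst \<rho> \<in> monomials C" and "\<not> reducible R (fst \<rho>)"
proof -
  let ?T = "T - {(l, r)} \<union> critical_pair \<rho> ` R"
  let ?E = "?T \<union> insert \<rho> R"
  obtain A B where \<rho>: "\<rho> = (A, B)" by force
  have R: "oriented R" and mono: "l \<in> monomials C" "r \<in> monomials C"
    using inv lr by (auto simp: invariant_def)
  have mono': "l' \<in> monomials C" "r' \<in> monomials C"
    using normal_form_monomial R nf mono by blast+
  \<comment> \<open>In either orientation the left-hand side is one of the two normal forms, hence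
    irreducible by \<open>R\<close>.\<close>
  have AB: "B \<prec> A" "(A, B) = (l', r') \<or> (A, B) = (r', l')"
    using orient mono' unfolding \<rho> by (auto elim: orient.cases simp: less_mono_def)
  then show "fst \<rho> \<in> monomials C" "\<not> reducible R (fst \<rho>)"
    using nf mono' unfolding \<rho> normal_form_def by auto
  have cp_less: "fst (critical_pair \<rho> \<sigma>) \<prec> fst \<rho> \<union># fst \<sigma>"
    "snd (critical_pair \<rho> \<sigma>) \<prec> fst \<rho> \<union># fst \<sigma>" if "\<sigma> \<in> R" for \<sigma>
  proof -
    obtain A' B' where \<sigma>: "\<sigma> = (A', B')" by force
    then have "B' \<prec> A'" using that orientedD[OF R] by blast
    from critical_pair_below[OF AB(1) this]
    show "fst (critical_pair \<rho> \<sigma>) \<prec> fst \<rho> \<union># fst \<sigma>"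
      "snd (critical_pair \<rho> \<sigma>) \<prec> fst \<rho> \<union># fst \<sigma>"
      by (simp_all only: \<rho> \<sigma> critical_pair_eq fst_conv snd_conv)
  qed
  have "conversion ?E (down A \<union> down B) A B" by (intro conversion_equation) (simp add: \<rho>)
  then have "conversion ?E (down l' \<union> down r') l' r'"
    using AB(2) conversion_sym by (auto simp: Un_commute)
  then have "conversion ?E (down l \<union> down r) l r"
    by (rule normal_forms_conversion[OF R _ mono nf, rotated]) auto
  then have replace: "conversion ?E (down A \<union> down B) A B" if "(A, B) \<in> T \<union> R" for A B
    using that by (cases "(A, B) = (l, r)") (auto intro: conversion_equation)
  have old: "peak_connected ?E \<sigma> \<tau>" if "\<sigma> \<in> R" "\<tau> \<in> R" for \<sigma> \<tau>
    using inv that peak_connected_replace[OF replace] unfolding invariant_def by blast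
  have new: "peak_connected ?E \<rho> \<sigma>" if "\<sigma> \<in> R" for \<sigma>
  proof -
    \<comment> \<open>The connecting chain is a single step, by this equation in the empty
      context.\<close>
    have "(fst (critical_pair \<rho> \<sigma>), snd (critical_pair \<rho> \<sigma>)) \<in> ?E" using that by simp
    from conversion_step[OF this, of "{#}"] show ?thesis
      using cp_less[OF that] by (simp add: peak_connected_def below_def)
  qed
  have "\<forall>\<sigma>\<in>insert \<rho> R. \<forall>\<tau>\<in>insert \<rho> R. peak_connected ?E \<sigma> \<tau>"
    using old new peak_connected_refl peak_connected_sym by blast
  moreover have "critical_pair \<rho> ` R \<subseteq> monomials C \<times> monomials C"
    by (intro image_subsetI, unfold mem_Times_iff) (blast intro: cp_less less_monoD(1))
  ultimately show "invariant ?T (insert \<rho> R)"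
    using inv AB(1) by (auto simp: invariant_def oriented_def \<rho>)
qed

text \<open>Collects what termination needs. When a rule is added, the witness \<open>L\<close> is
  its left-hand side.\<close>

lemma completion_step_cases:
  assumes "completion_step gtf (T, R) (T', R')" and inv: "invariant T R"
  shows "invariant T' R'"
    and "reducible R M \<Longrightarrow> reducible R' M"
    and "(R' = R \<and> card T' < card T) \<or>
         (\<exists>L\<in>monomials C. \<not> reducible R L \<and> reducible R' L)"
proof -
  have "invariant T' R' \<and> (\<forall>M. reducible R M \<longrightarrow> reducible R' M) \<and>
    ((R' = R \<and> card T' < card T) \<or> (\<exists>L\<in>monomials C. \<not> reducible R L \<and> reducible R' L))"
    using assms(1)
  proof cases
    case (discard l r l' r')
    then have "card T' < card T" using inv by (metis invariant_def card_Diff1_less)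
    then show ?thesis using discard inv invariant_discard by blast
  next
    case (add_rule l r l' r' \<rho>)
    note add = invariant_add[OF inv add_rule(1-3,5)]
    have inter: "invariant T' R'" "\<And>M. reducible (insert \<rho> R) M \<Longrightarrow> reducible R' M"
      using interreduce_invariant[OF add_rule(6) add(1)] by auto
    have "reducible (insert \<rho> R) (fst \<rho>)" by (cases \<rho>) (auto simp: reducible_iff)
    then show ?thesis using inter add(2,3) by (auto simp: reducible_iff)
  qed
  then show "invariant T' R'" "reducible R M \<Longrightarrow> reducible R' M"
    "(R' = R \<and> card T' < card T) \<or> (\<exists>L\<in>monomials C. \<not> reducible R L \<and> reducible R' L)"
    by blast+
qed

text \<open>Totality of the ordering orients any two distinct normal forms. Hence a run can stop
  only when \<open>T\<close> is empty.\<close>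

lemma completion_step_exists:
  assumes inv: "invariant T R" and "T \<noteq> {}"
  shows "\<exists>s. completion_step gtf (T, R) s"
proof -
  obtain l r where lr: "(l, r) \<in> T" using assms(2) by auto
  have R: "oriented R" "finite R" and mono: "l \<in> monomials C" "r \<in> monomials C"
    using inv lr by (auto simp: invariant_def)
  obtain l' r' where nf: "normal_form R l l'" "normal_form R r r'"
    using normal_form_exists[OF R(1)] mono by metis
  show ?thesis
  proof (cases "l' = r'")
    case True
    then show ?thesis using completion_step.discard[OF lr nf] by blast
  next
    case False
    have "l' \<in> monomials C" "r' \<in> monomials C"
      using normal_form_monomial R nf mono by blast+
    then obtain \<rho> where \<rho>: "orient gtf l' r' \<rho>"
      using less_mono_total[OF _ _ False] orient.intros unfolding less_mono_def by metis
    obtain T' R' where "interreduce \<rho> (R - {\<rho>}) (T - {(l, r)} \<union> critical_pair \<rho> ` R)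
        (insert \<rho> R) T' R'"
      using interreduce_total[OF _ invariant_add(1)[OF inv lr nf \<rho>], of "R - {\<rho>}" \<rho>] R(2) by auto
    then show ?thesis using completion_step.add_rule[OF lr nf False \<rho>] by blast
  qed
qed

section \<open>The initial state\<close>

text \<open>The class of \<open>c\<close> stays inside the finite set \<open>C\<close>, so it has a
  unique least element and the description in \<open>least_rep\<close> is proper.\<close>

lemma least_rep_less:
  assumes C: "finite C" "strict_total_order_on C gt" and SC: "SC \<subseteq> C \<times> C"
    and c: "c \<in> C" "c \<noteq> least_rep SC gt c"
  shows "{#least_rep SC gt c#} \<prec> {#c#}"
proof -
  define K where "K = {d. equivclp (\<lambda>x y. (x, y) \<in> SC) c d}"
  have "d \<in> C" if "equivclp (\<lambda>x y. (x, y) \<in> SC) c d" for d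
    using that by (induction rule: equivclp_induct) (use c SC in auto)
  then have K: "K \<subseteq> C" "c \<in> K" by (auto simp: K_def)
  have "finite K" using K C(1) finite_subset by blast
  have gt: "irreflp_on K gt" "transp_on K gt" "totalp_on K gt"
    using C(2) K(1) unfolding strict_total_order_on_def
    by (auto intro: irreflp_on_subset transp_on_subset totalp_on_subset)
  have "asymp_on K gt" using gt(1,2) by (simp add: asymp_on_iff_irreflp_on_if_transp_on)
  \<comment> \<open>The library fact takes its relation as "less than"; a maximal element for
    \<open>gt\<close> is thus a smallest constant.\<close>
  then obtain d where d: "d \<in> K" "\<forall>e\<in>K. e \<noteq> d \<longrightarrow> \<not> gt d e"
    using Finite_Set.bex_max_element[OF \<open>finite K\<close> _ gt(2)] K(2) by blast
  then have min: "\<forall>e\<in>K. e \<noteq> d \<longrightarrow> gt e d" using gt(3) by (auto dest: totalp_onD)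
  have "least_rep SC gt c = d"
    unfolding least_rep_def
  proof (rule the_equality)
    show "equivclp (\<lambda>x y. (x, y) \<in> SC) c d \<and>
      (\<forall>e. equivclp (\<lambda>x y. (x, y) \<in> SC) c e \<and> e \<noteq> d \<longrightarrow> gt e d)"
      using d(1) min by (auto simp: K_def)
    fix d' assume "equivclp (\<lambda>x y. (x, y) \<in> SC) c d' \<and>
      (\<forall>e. equivclp (\<lambda>x y. (x, y) \<in> SC) c e \<and> e \<noteq> d' \<longrightarrow> gt e d')"
    then show "d' = d" using d by (auto simp: K_def)
  qed
  then show ?thesis using less_mono_singleton min K d(1) c by auto
qed

text \<open>Two distinct constant rules act on different constants, so applying both closes their
  peak, below the overlap.\<close>

lemma invariant_initial:
  assumes C: "finite C" "strict_total_order_on C gt" and SC: "SC \<subseteq> C \<times> C"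
    and Sf: "finite Sf" "Sf \<subseteq> monomials C \<times> monomials C"
  shows "invariant Sf (constant_rules C SC gt)"
proof -
  let ?R = "constant_rules C SC gt"
  let ?rep = "least_rep SC gt"
  have R: "oriented ?R"
    using least_rep_less[OF C SC] by (auto simp: oriented_def constant_rules_def)
  have "?R \<subseteq> (\<lambda>c. ({#c#}, {#?rep c#})) ` C" by (auto simp: constant_rules_def)
  then have fin: "finite ?R" using C(1) finite_surj by blast
  have "peak_connected (Sf \<union> ?R) \<rho> \<sigma>" if \<rho>\<sigma>: "\<rho> \<in> ?R" "\<sigma> \<in> ?R" "\<rho> \<noteq> \<sigma>" for \<rho> \<sigma>
  proof -
    obtain c where c: "\<rho> = ({#c#}, {#?rep c#})" "c \<in> C" "c \<noteq> ?rep c"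
      using \<rho>\<sigma>(1) by (auto simp: constant_rules_def)
    obtain d where d: "\<sigma> = ({#d#}, {#?rep d#})" "d \<in> C" "d \<noteq> ?rep d"
      using \<rho>\<sigma>(2) by (auto simp: constant_rules_def)
    \<comment> \<open>A constant has at most one rule, since its right-hand side is determined by
      it.\<close>
    have "c \<noteq> d" using \<rho>\<sigma>(3) c d by auto
    then have X: "{#c#} \<union># {#d#} = {#c, d#}"
      by (auto simp: multiset_eq_iff)
    have less: "{#?rep c#} \<prec> {#c#}" "{#?rep d#} \<prec> {#d#}"
      using least_rep_less[OF C SC] c d by auto
    then have rep: "?rep c \<in> C" "?rep d \<in> C"
      using less_monoD(1)[OF less(1)] less_monoD(1)[OF less(2)] by (auto simp: monomials_def)
    have "{#?rep c, d#} \<prec> {#c, d#}" "{#c, ?rep d#} \<prec> {#c, d#}"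
      "{#?rep c, ?rep d#} \<prec> {#c, ?rep d#}"
      using less_mono_add[OF less(1), of "{#d#}"] less_mono_add[OF less(2), of "{#c#}"]
        less_mono_add[OF less(1), of "{#?rep d#}"] c d rep
      by (auto simp: add_mset_commute)
    then have S: "{#?rep c, d#} \<in> below {#c, d#}" "{#c, ?rep d#} \<in> below {#c, d#}"
      "{#?rep c, ?rep d#} \<in> below {#c, d#}"
      by (auto simp: below_def intro: less_mono_trans)
    have "conversion (Sf \<union> ?R) (below {#c, d#}) {#?rep c, d#} {#?rep c, ?rep d#}"
      using conversion_step[of "{#d#}" "{#?rep d#}" "Sf \<union> ?R" "{#?rep c#}"] S \<rho>\<sigma> d
      by (auto simp: add_mset_commute)
    moreover have "conversion (Sf \<union> ?R) (below {#c, d#}) {#c, ?rep d#} {#?rep c, ?rep d#}"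
      using conversion_step[of "{#c#}" "{#?rep c#}" "Sf \<union> ?R" "{#?rep d#}"] S \<rho>\<sigma> c
      by (auto simp: add_mset_commute)
    ultimately have "conversion (Sf \<union> ?R) (below {#c, d#}) {#?rep c, d#} {#c, ?rep d#}"
      using conversion_sym conversion_trans by blast
    then show ?thesis
      unfolding peak_connected_def c d critical_pair_eq fst_conv snd_conv X
      by (simp add: add_mset_commute)
  qed
  then have "\<forall>\<rho>\<in>?R. \<forall>\<sigma>\<in>?R. peak_connected (Sf \<union> ?R) \<rho> \<sigma>"
    using peak_connected_refl by metis
  then show ?thesis using R fin Sf by (simp add: invariant_def)
qed


section \<open>Termination\<close>

lemma completion_terminates:
  assumes C: "finite C" and init: "invariant (fst (s 0)) (snd (s 0))"
  shows "\<not> (\<forall>i::nat. completion_step gtf (s i) (s (Suc i)))"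
proof
  assume step: "\<forall>i. completion_step gtf (s i) (s (Suc i))"
  define T R where "T = (\<lambda>i. fst (s i))" and "R = (\<lambda>i. snd (s i))"
  have step: "completion_step gtf (T i, R i) (T (Suc i), R (Suc i))" for i
    using step by (simp add: T_def R_def)
  have inv: "invariant (T i) (R i)" for i
    by (induction i) (use init completion_step_cases(1)[OF step] in \<open>auto simp: T_def R_def\<close>)
  have red_mono: "reducible (R j) M" if "reducible (R i) M" "i \<le> j" for i j M
    using that(2,1)
    by (induction rule: dec_induct) (auto intro: completion_step_cases(2)[OF step inv])
  \<comment> \<open>The passes that make some monomial reducible for the first time; all others
    shrink \<open>T\<close>.\<close>
  define I where "I = {i. \<exists>L\<in>monomials C. \<not> reducible (R i) L \<and> reducible (R (Suc i)) L}"
  have dec: "card (T (Suc i)) < card (T i)" if "i \<notin> I" for i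
    using completion_step_cases(3)[OF step inv, of i] that by (auto simp: I_def)
  show False
  proof (cases "finite I")
    case True
    then obtain n where n: "\<And>i. i \<ge> n \<Longrightarrow> i \<notin> I"
      by (metis finite_nat_set_iff_bounded linorder_not_less)
    have "card (T (n + k)) + k \<le> card (T n)" for k
    proof (induction k)
      case (Suc k)
      then show ?case using dec[OF n, of "n + k"] by simp
    qed simp
    from this[of "Suc (card (T n))"] show False by simp
  next
    case False
    have "\<exists>L\<in>monomials C. \<not> reducible (R (enumerate I k)) L \<and>
        reducible (R (Suc (enumerate I k))) L" for k
      using enumerate_in_set[OF False, of k] by (simp add: I_def)
    \<comment> \<open>\<open>L k\<close> is irreducible just before the \<open>k\<close>-th pass in
      \<open>I\<close> and reducible just after it. So an earlier \<open>L i\<close> is already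
      reducible before pass \<open>j\<close>, and a later \<open>L j\<close> cannot contain
      it.\<close>
    then obtain L where L: "\<And>k. L k \<in> monomials C" "\<And>k. \<not> reducible (R (enumerate I k)) (L k)"
      "\<And>k. reducible (R (Suc (enumerate I k))) (L k)" by metis
    obtain i j where ij: "i < j" "L i \<subseteq># L j"
      using dickson_multiset[OF C, of L] L(1) by (auto simp: monomials_def)
    have "Suc (enumerate I i) \<le> enumerate I j"
      using enumerate_mono[OF ij(1) False] by simp
    then have "reducible (R (enumerate I j)) (L i)" using red_mono L(3) by blast
    then have "reducible (R (enumerate I j)) (L j)"
      using ij(2) unfolding reducible_iff by (auto intro: subset_mset.order_trans)
    then show False using L(2) by blast
  qed
qed

text \<open>The invariant holds along the run, and a state without successor has no equation
  left.\<close>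

lemma completion_stuck_finished:
  assumes inv: "invariant T R"
    and steps: "(completion_step gtf)\<^sup>*\<^sup>* (T, R) s" and stuck: "\<nexists>s'. completion_step gtf s s'"
  shows "completion_finished s"
proof -
  from steps have "invariant (fst s) (snd s)"
  proof induction
    case base
    then show ?case using inv by simp
  next
    case (step s s')
    then show ?case using completion_step_cases(1)[of "fst s" "snd s" "fst s'" "snd s'"] by simp
  qed
  then have "invariant (fst s) (snd s)" "fst s = {}"
    using completion_step_exists[of "fst s" "snd s"] stuck by auto
  then show ?thesis using invariant_finished[of "snd s"] by (metis prod.collapse)
qed

end

theorem theorem3p4:
  fixes C :: "'c set"
    and SC :: "('c \<times> 'c) set"
    and Sf :: "('c multiset \<times> 'c multiset) set"
    and gt :: "'c \<Rightarrow> 'c \<Rightarrow> bool"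
    and gtf :: "'c multiset \<Rightarrow> 'c multiset \<Rightarrow> bool"
  assumes "finite C"
    and "finite SC" and "SC \<subseteq> C \<times> C"
    and "finite Sf" and "Sf \<subseteq> monomials C \<times> monomials C"
    and "strict_total_order_on C gt"
    and "admissible C gt gtf"
  shows "\<not> (\<exists>s. s 0 = initial_state C SC Sf gt \<and>
               (\<forall>i::nat. completion_step gtf (s i) (s (Suc i)))) \<and>
         (\<forall>s. (completion_step gtf)\<^sup>*\<^sup>* (initial_state C SC Sf gt) s \<and>
             (\<nexists>s'. completion_step gtf s s') \<longrightarrow> completion_finished s)"
proof -
  interpret admissible_order C gt gtf by unfold_locales (rule assms(7))
  have init: "invariant Sf (constant_rules C SC gt)"
    using invariant_initial assms by blast
  then show ?thesis
    using completion_terminates[OF assms(1)] completion_stuck_finished[OF init]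
    unfolding initial_state_def by (metis fst_conv snd_conv)
qed

end
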